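(* Let $\alpha,\beta$ be positive quadratic irrationals and let $A,B\in GL(2,\mathbb Z)$ be non-identity matrices with $\operatorname{Aut}(\mathcal A_\alpha)\cong\mathbb T^2\rtimes_{\psi_A}\mathbb Z$ and $\operatorname{Aut}(\mathcal A_\beta)\cong\mathbb T^2\rtimes_{\psi_B}\mathbb Z$. Then $\operatorname{Aut}(\mathcal A_\alpha)\cong\operatorname{Aut}(\mathcal A_\beta)$ if and only if there exists $C\in GL(2,\mathbb Z)$ with $B=C^{-1}AC$ or $B^{-1}=C^{-1}AC$.
   Context: For a positive irrational $\alpha$, $\mathcal A_\alpha=\{f\in C(\mathbb T^2): \hat f(m,n)=0 \text{ whenever } m+\alpha n<0\}$ (with $\mathbb T$ the unit circle and $\hat f$ the Fourier transform on $\mathbb Z^2$), a uniform algebra with the sup norm, and $\operatorname{Aut}(\mathcal A_\alpha)$ is its group of isometric automorphisms. For $A=\begin{bmatrix} a&b\\ c&d\end{bmatrix}\in GL(2,\mathbb Z)$, $\psi_A:\mathbb T^2\to\mathbb T^2$ is $\psi_A(c_1,c_2)=(c_1^ac_2^b,c_1^cc_2^d)$; the (continuous) automorphisms of the group $\mathbb T^2$ are exactly the $\psi_A$. The semidirect product $\mathbb T^2\rtimes_{\psi_A}\mathbb Z$ has multiplication $(\mathbf c,m)\cdot(\mathbf d,n)=(\mathbf c\,\psi_A^m(\mathbf d),m+n)$. Isomorphisms of these semidirect products are understood with automorphisms of $\mathbb T^2$ taken in the continuous sense (i.e. as topological groups). *)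

theory Defs
  imports "HOL-Analysis.Analysis" "HOL-Algebra.Group"
begin

section \<open>The torus and the algebra A_alpha\<close>

definition torus2 :: "(complex \<times> complex) set" where
  "torus2 = {(z, w). cmod z = 1 \<and> cmod w = 1}"

text \<open>Fourier coefficient of f on T^2 at (m,n), normalised Haar measure.\<close>
definition fourier2 :: "(complex \<times> complex \<Rightarrow> complex) \<Rightarrow> int \<Rightarrow> int \<Rightarrow> complex" where
  "fourier2 f m n = complex_of_real (1 / (4 * pi\<^sup>2)) *
     integral (cbox (0, 0) (2 * pi, 2 * pi))
       (\<lambda>(s, t). f (cis s, cis t) * cis (- (of_int m * s + of_int n * t)))"

text \<open>Elements of C(T^2) are represented as functions that vanish off T^2
  (extensional), so that equality of functions is equality on T^2.\<close>
definition CT2 :: "(complex \<times> complex \<Rightarrow> complex) set" where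
  "CT2 = {f. continuous_on torus2 f \<and> f \<in> extensional torus2}"

definition A_alg :: "real \<Rightarrow> (complex \<times> complex \<Rightarrow> complex) set" where
  "A_alg \<alpha> = {f \<in> CT2. \<forall>m n::int. of_int m + \<alpha> * of_int n < 0 \<longrightarrow> fourier2 f m n = 0}"

definition supnorm :: "(complex \<times> complex \<Rightarrow> complex) \<Rightarrow> real" where
  "supnorm f = (SUP x\<in>torus2. cmod (f x))"

text \<open>Isometric (algebra) automorphisms of A_alpha.\<close>
definition Aut_set :: "real \<Rightarrow> ((complex \<times> complex \<Rightarrow> complex) \<Rightarrow> (complex \<times> complex \<Rightarrow> complex)) set" where
  "Aut_set \<alpha> = {\<Phi>. \<Phi> \<in> extensional (A_alg \<alpha>) \<and> bij_betw \<Phi> (A_alg \<alpha>) (A_alg \<alpha>)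
     \<and> (\<forall>f\<in>A_alg \<alpha>. \<forall>g\<in>A_alg \<alpha>. \<Phi> (\<lambda>x. f x + g x) = (\<lambda>x. \<Phi> f x + \<Phi> g x) \<and> \<Phi> (\<lambda>x. f x * g x) = (\<lambda>x. \<Phi> f x * \<Phi> g x))
     \<and> (\<forall>c::complex. \<forall>f\<in>A_alg \<alpha>. \<Phi> (\<lambda>x. c * f x) = (\<lambda>x. c * \<Phi> f x))
     \<and> (\<forall>f\<in>A_alg \<alpha>. supnorm (\<Phi> f) = supnorm f)}"

definition AutG :: "real \<Rightarrow> ((complex \<times> complex \<Rightarrow> complex) \<Rightarrow> (complex \<times> complex \<Rightarrow> complex)) monoid" where
  "AutG \<alpha> = \<lparr>carrier = Aut_set \<alpha>, monoid.mult = (\<lambda>\<Phi> \<Psi>. compose (A_alg \<alpha>) \<Phi> \<Psi>),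
            one = restrict id (A_alg \<alpha>)\<rparr>"

text \<open>Topology on Aut(A_alpha): point-norm (strong) topology, generated by the sets
  {Phi. ||Phi f - g|| < r}.\<close>
definition AutTop :: "real \<Rightarrow> ((complex \<times> complex \<Rightarrow> complex) \<Rightarrow> (complex \<times> complex \<Rightarrow> complex)) topology" where
  "AutTop \<alpha> = topology_generated_by
     (insert (Aut_set \<alpha>)
       {{\<Phi> \<in> Aut_set \<alpha>. supnorm (\<lambda>x. \<Phi> f x - g x) < r} | f g r. f \<in> A_alg \<alpha> \<and> g \<in> CT2 \<and> r > 0})"

section \<open>GL(2,Z), psi_A and the semidirect product\<close>

definition GL2Z :: "(int^2^2) set" where
  "GL2Z = {A. invertible A}"

definition psi :: "int^2^2 \<Rightarrow> complex \<times> complex \<Rightarrow> complex \<times> complex" where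
  "psi A = (\<lambda>(c1, c2). (c1 powi (A$1$1) * c2 powi (A$1$2), c1 powi (A$2$1) * c2 powi (A$2$2)))"

text \<open>Integer matrix powers (A^m = (A^{-1})^{-m} for m < 0).\<close>
definition mpow :: "int^2^2 \<Rightarrow> int \<Rightarrow> int^2^2" where
  "mpow A m = (if m \<ge> 0 then (((**) A) ^^ nat m) (mat 1)
               else (((**) (matrix_inv A)) ^^ nat (- m)) (mat 1))"

text \<open>psi_A^m = psi_{A^m}.\<close>
definition semidirect :: "int^2^2 \<Rightarrow> ((complex \<times> complex) \<times> int) monoid" where
  "semidirect A = \<lparr>carrier = torus2 \<times> UNIV,
     monoid.mult = (\<lambda>(c, m) (d, n). let d' = psi (mpow A m) d in ((fst c * fst d', snd c * snd d'), m + n)),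
     one = ((1, 1), 0)\<rparr>"

definition semidirectTop :: "((complex \<times> complex) \<times> int) topology" where
  "semidirectTop = prod_topology (subtopology euclidean torus2) (discrete_topology UNIV)"

text \<open>Isomorphism of topological groups.\<close>
definition top_group_iso :: "('a, 'c) monoid_scheme \<Rightarrow> 'a topology \<Rightarrow> ('b, 'd) monoid_scheme \<Rightarrow> 'b topology \<Rightarrow> bool" where
  "top_group_iso G X H Y \<longleftrightarrow> (\<exists>\<phi>. \<phi> \<in> iso G H \<and> homeomorphic_map X Y \<phi>)"

definition quadratic_irrational :: "real \<Rightarrow> bool" where
  "quadratic_irrational x \<longleftrightarrow> x \<notin> \<rat> \<and>
     (\<exists>a b c :: int. a \<noteq> 0 \<and> of_int a * x\<^sup>2 + of_int b * x + of_int c = 0)"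

end

theory Submission
  imports Defs
begin

text \<open>The hypotheses identify \<open>Aut(\<A>\<^sub>\<alpha>)\<close> and \<open>Aut(\<A>\<^sub>\<beta>)\<close> with \<open>\<T>\<^sup>2 \<rtimes>\<^sub>A \<int>\<close> and
  \<open>\<T>\<^sup>2 \<rtimes>\<^sub>B \<int>\<close>, so everything reduces to these semidirect products.
  A continuous isomorphism \<open>\<phi>\<close> between them maps the identity component \<open>\<T>\<^sup>2 \<times> {0}\<close> onto itself,
  so it restricts to a continuous automorphism of \<open>\<T>\<^sup>2\<close>; since the continuous characters of the
  circle are the maps \<open>z \<mapsto> z\<^sup>n\<close>, this restriction is \<open>\<psi>\<^sub>C\<close> with \<open>C \<in> GL(2,\<int>)\<close>.
  On the quotient \<open>\<int>\<close> it induces multiplication by a unit \<open>k = \<plusminus>1\<close>, and comparing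
  \<open>\<phi>(g (c,0)) = \<phi>((\<psi>\<^sub>A c, 0) g)\<close> for the generator \<open>g = (1,1)\<close> gives \<open>B\<^sup>k C = C A\<close>.
  Conversely, if \<open>B\<^sup>s = C\<^sup>-\<^sup>1 A C\<close> with \<open>s = \<plusminus>1\<close>, then \<open>(c, m) \<mapsto> (\<psi>\<^sub>D c, s m)\<close> with
  \<open>D = C\<^sup>-\<^sup>1\<close> is a topological isomorphism.\<close>

section \<open>Inverses and integer powers of matrices\<close>

lemma matrix_inv_inverse:
  fixes A :: "'a::semiring_1^'n^'m"
  assumes "invertible A"
  shows "A ** matrix_inv A = mat 1 \<and> matrix_inv A ** A = mat 1"
  using assms unfolding invertible_def matrix_inv_def
  by (rule someI_ex[of "\<lambda>A'. A ** A' = mat 1 \<and> A' ** A = mat 1"])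

lemma matrix_inv_right: "invertible A \<Longrightarrow> A ** matrix_inv A = mat 1"
  by (simp add: matrix_inv_inverse)

lemma matrix_inv_left: "invertible A \<Longrightarrow> matrix_inv A ** A = mat 1"
  by (simp add: matrix_inv_inverse)

lemma matrix_inv_unique:
  fixes A :: "'a::semiring_1^'n^'m"
  assumes AB: "A ** B = mat 1" and BA: "B ** A = mat 1"
  shows "matrix_inv A = B"
proof -
  have A: "invertible A"
    using AB BA unfolding invertible_def by blast
  have "matrix_inv A = matrix_inv A ** (A ** B)"
    by (simp add: AB)
  also have "\<dots> = B"
    by (simp add: matrix_mul_assoc matrix_inv_left[OF A])
  finally show ?thesis .
qed

lemma matrix_inv_matrix_inv:
  fixes A :: "'a::semiring_1^'n^'m"
  assumes "invertible A"
  shows "matrix_inv (matrix_inv A) = A"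
  by (rule matrix_inv_unique) (simp_all add: matrix_inv_left matrix_inv_right assms)

lemma matrix_conj_mult:
  fixes C X Y :: "'a::semiring_1^'n^'n"
  assumes "invertible C"
  shows "(matrix_inv C ** X ** C) ** (matrix_inv C ** Y ** C) = matrix_inv C ** (X ** Y) ** C"
proof -
  have "(matrix_inv C ** X ** C) ** (matrix_inv C ** Y ** C)
      = matrix_inv C ** X ** (C ** matrix_inv C) ** Y ** C"
    by (simp add: matrix_mul_assoc)
  then show ?thesis
    by (simp add: matrix_inv_right[OF assms] matrix_mul_assoc)
qed

lemma matrix_inv_conj:
  fixes A C :: "'a::semiring_1^'n^'n"
  assumes C: "invertible C" and A: "invertible A"
  shows "matrix_inv (matrix_inv C ** A ** C) = matrix_inv C ** matrix_inv A ** C"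
  by (rule matrix_inv_unique)
    (simp_all add: matrix_conj_mult[OF C] matrix_inv_right[OF A] matrix_inv_left[OF A]
      matrix_inv_left[OF C])

lemma funpow_matrix_mult_conj:
  fixes A C :: "'a::semiring_1^'n^'n"
  assumes "invertible C"
  shows "(((**) (matrix_inv C ** A ** C)) ^^ n) (mat 1) = matrix_inv C ** (((**) A) ^^ n) (mat 1) ** C"
proof (induction n)
  case 0
  then show ?case by (simp add: matrix_inv_left[OF assms])
next
  case (Suc n)
  then show ?case by (simp add: matrix_conj_mult[OF assms])
qed

lemma mpow_0 [simp]: "mpow A 0 = mat 1"
  by (simp add: mpow_def)

lemma mpow_1 [simp]: "mpow A 1 = A"
  by (simp add: mpow_def)

lemma mpow_minus_1 [simp]: "mpow A (-1) = matrix_inv A"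
  by (simp add: mpow_def)

lemma mpow_conj:
  assumes C: "invertible C" and A: "invertible A"
  shows "mpow (matrix_inv C ** A ** C) m = matrix_inv C ** mpow A m ** C"
  by (simp add: mpow_def funpow_matrix_mult_conj C matrix_inv_conj[OF C A])

lemma mpow_matrix_inv:
  assumes "invertible B"
  shows "mpow (matrix_inv B) m = mpow B (- m)"
  by (simp add: mpow_def matrix_inv_matrix_inv[OF assms])

section \<open>The torus and the maps \<open>\<psi>\<^sub>A\<close>\<close>

definition torus_mult :: "complex \<times> complex \<Rightarrow> complex \<times> complex \<Rightarrow> complex \<times> complex" where
  "torus_mult c d = (fst c * fst d, snd c * snd d)"

lemma one_in_torus2 [simp]: "(1, 1) \<in> torus2"
  by (simp add: torus2_def)

lemma torus2_nonzero: "c \<in> torus2 \<Longrightarrow> fst c \<noteq> 0 \<and> snd c \<noteq> 0"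
  by (cases c) (auto simp: torus2_def)

lemma torus_mult_in_torus2: "c \<in> torus2 \<Longrightarrow> d \<in> torus2 \<Longrightarrow> torus_mult c d \<in> torus2"
  by (cases c, cases d) (simp add: torus_mult_def torus2_def norm_mult)

lemma torus_mult_one_left [simp]: "torus_mult (1, 1) c = c"
  by (simp add: torus_mult_def)

lemma torus_mult_one_right [simp]: "torus_mult c (1, 1) = c"
  by (simp add: torus_mult_def)

lemma torus_mult_cancel: "d \<in> torus2 \<Longrightarrow> torus_mult d x = torus_mult y d \<Longrightarrow> x = y"
  by (cases d, cases x, cases y) (auto simp: torus_mult_def torus2_def mult.commute)

lemma connected_torus2: "connected torus2"
proof -
  have "torus2 = (\<lambda>p. (cis (fst p), cis (snd p))) ` UNIV"
  proof
    show "torus2 \<subseteq> (\<lambda>p. (cis (fst p), cis (snd p))) ` UNIV"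
    proof
      fix c assume "c \<in> torus2"
      then obtain z w where c: "c = (z, w)" "cmod z = 1" "cmod w = 1"
        by (cases c) (auto simp: torus2_def)
      then have "c = (cis (Arg z), cis (Arg w))"
        using rcis_cmod_Arg[of z] rcis_cmod_Arg[of w] by (simp add: rcis_def)
      then show "c \<in> (\<lambda>p. (cis (fst p), cis (snd p))) ` UNIV"
        by (auto intro!: image_eqI[where x = "(Arg z, Arg w)"])
    qed
  qed (auto simp: torus2_def)
  moreover have "connected ((\<lambda>p. (cis (fst p), cis (snd p))) ` (UNIV :: (real \<times> real) set))"
    by (intro connected_continuous_image connected_UNIV continuous_intros)
  ultimately show ?thesis
    by simp
qed

lemma psi_in_torus2: "c \<in> torus2 \<Longrightarrow> psi A c \<in> torus2"
  by (cases c) (auto simp: psi_def torus2_def norm_mult norm_power_int)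

lemma psi_one [simp]: "psi A (1, 1) = (1, 1)"
  by (simp add: psi_def)

lemma psi_mat_1 [simp]: "psi (mat 1) c = c"
  by (cases c) (simp add: psi_def mat_def)

lemma psi_torus_mult: "psi A (torus_mult c d) = torus_mult (psi A c) (psi A d)"
  by (cases c, cases d) (simp add: psi_def torus_mult_def power_int_mult_distrib mult_ac)

lemma psi_psi:
  assumes "c \<in> torus2"
  shows "psi A (psi B c) = psi (A ** B) c"
proof (cases c)
  case (Pair c1 c2)
  then have "c1 \<noteq> 0" "c2 \<noteq> 0"
    using torus2_nonzero[OF assms] by auto
  then show ?thesis
    by (simp add: Pair psi_def matrix_matrix_mult_def sum_2 power_int_mult_distrib
        power_int_add power_int_mult[symmetric] mult_ac)
qed

lemma power_int_circle_inject:
  assumes "\<And>z::complex. cmod z = 1 \<Longrightarrow> z powi a = z powi b"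
  shows "a = b"
proof (rule ccontr)
  assume ab: "a \<noteq> b"
  define z where "z = cis (pi / of_int (a - b))"
  have "z powi (a - b) = -1"
    using ab by (simp add: z_def cis_power_int)
  moreover have "z powi (a - b) = 1"
    using assms[of z] by (simp add: z_def power_int_diff)
  ultimately show False by simp
qed

lemma psi_inject:
  assumes "\<And>c. c \<in> torus2 \<Longrightarrow> psi A c = psi B c"
  shows "A = B"
proof -
  have col1: "A$i$1 = B$i$1" for i
  proof (rule power_int_circle_inject)
    fix z :: complex assume "cmod z = 1"
    then have "psi A (z, 1) = psi B (z, 1)"
      using assms by (simp add: torus2_def)
    then show "z powi (A$i$1) = z powi (B$i$1)"
      using exhaust_2[of i] by (auto simp: psi_def)
  qed
  have col2: "A$i$2 = B$i$2" for i
  proof (rule power_int_circle_inject)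
    fix z :: complex assume "cmod z = 1"
    then have "psi A (1, z) = psi B (1, z)"
      using assms by (simp add: torus2_def)
    then show "z powi (A$i$2) = z powi (B$i$2)"
      using exhaust_2[of i] by (auto simp: psi_def)
  qed
  show ?thesis
    unfolding vec_eq_iff forall_2 using col1 col2 by blast
qed

lemma continuous_on_psi: "continuous_on torus2 (psi A)"
proof -
  have "psi A = (\<lambda>c. (fst c powi (A$1$1) * snd c powi (A$1$2), fst c powi (A$2$1) * snd c powi (A$2$2)))"
    by (rule ext) (simp add: psi_def split: prod.splits)
  then show ?thesis
    by (simp, intro continuous_intros) (auto dest: torus2_nonzero)
qed

section \<open>Continuous endomorphisms of the torus\<close>

lemma additive_scaleR_of_int:
  fixes G :: "real \<Rightarrow> 'a::real_vector"
  assumes add: "\<And>s t. G (s + t) = G s + G t"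
  shows "G (of_int k * x) = of_int k *\<^sub>R G x"
proof -
  have G0: "G 0 = 0"
    using add[of 0 0] by simp
  have nat: "G (of_nat n * x) = of_nat n *\<^sub>R G x" for n
    by (induction n) (simp_all add: G0 add distrib_right scaleR_left_distrib add.commute)
  have neg: "G (- y) = - G y" for y
    using add[of y "- y"] G0 by (simp add: eq_neg_iff_add_eq_0 add.commute)
  show ?thesis
  proof (cases "k \<ge> 0")
    case True
    then show ?thesis using nat[of "nat k"] by simp
  next
    case False
    then have "of_int k * x = - (of_nat (nat (- k)) * x)" by simp
    then show ?thesis using nat[of "nat (- k)"] neg False by simp
  qed
qed

lemma continuous_additive_linear:
  fixes G :: "real \<Rightarrow> 'a::real_normed_vector"
  assumes add: "\<And>s t. G (s + t) = G s + G t" and cont: "continuous_on UNIV G"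
  shows "G t = t *\<^sub>R G 1"
proof -
  have "G q = q *\<^sub>R G 1" if "q \<in> \<rat>" for q
  proof -
    obtain a b where ab: "q = of_int a / of_int b" "b > 0"
      using \<open>q \<in> \<rat>\<close> by (metis Rats_cases')
    have "of_int b *\<^sub>R G (1 / of_int b) = G (of_int b * (1 / of_int b))"
      by (rule additive_scaleR_of_int[OF add, symmetric])
    also have "\<dots> = G 1"
      using ab by simp
    finally have "(1 / of_int b) *\<^sub>R G 1 = (1 / of_int b) *\<^sub>R (of_int b *\<^sub>R G (1 / of_int b))"
      by (simp only:)
    then have "G (1 / of_int b) = (1 / of_int b) *\<^sub>R G 1"
      using ab by (simp add: scaleR_scaleR)
    moreover have "G q = of_int a *\<^sub>R G (1 / of_int b)"
      using additive_scaleR_of_int[OF add, of a "1 / of_int b"] ab by simp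
    ultimately show ?thesis
      using ab by simp
  qed
  then have "\<rat> \<subseteq> {x. G x = x *\<^sub>R G 1}"
    by blast
  moreover have "closed {x. G x = x *\<^sub>R G 1}"
    by (rule closed_Collect_eq[OF cont]) (intro continuous_intros)
  ultimately have "closure \<rat> \<subseteq> {x. G x = x *\<^sub>R G 1}"
    by (rule closure_minimal)
  then have "t \<in> {x. G x = x *\<^sub>R G 1}"
    using Rats_closure_real by blast
  then show ?thesis
    by (simp only: mem_Collect_eq)
qed

lemma continuous_multiplicative_exp_lift:
  fixes f :: "real \<Rightarrow> complex"
  assumes cont: "continuous_on UNIV f" and nonzero: "\<And>t. f t \<noteq> 0"
    and mult: "\<And>s t. f (s + t) = f s * f t"
  shows "\<exists>G. continuous_on UNIV G \<and> (\<forall>s t. G (s + t) = G s + G t) \<and> (\<forall>t. f t = exp (G t))"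
proof -
  obtain g where contg: "continuous_on UNIV g" and fg: "\<And>t. t \<in> UNIV \<Longrightarrow> f t = exp (g t)"
    using continuous_logarithm_on_contractible[OF cont contractible_UNIV] nonzero by blast
  define h where "h p = (g (fst p + snd p) - g (fst p) - g (snd p)) / (2 * pi * \<i>)" for p :: "real \<times> real"
  have h_int: "\<exists>k::int. h p = of_int k" for p
  proof -
    have "exp (g (fst p + snd p)) = exp (g (fst p) + g (snd p))"
      using mult[of "fst p" "snd p"] by (simp add: fg exp_add)
    then obtain k :: int where "g (fst p + snd p) = g (fst p) + g (snd p) + (of_int (2 * k) * pi) * \<i>"
      using exp_eq by blast
    then have "h p = of_int k"
      by (simp add: h_def field_simps)
    then show ?thesis by blast
  qed
  have g_comp: "continuous_on UNIV (\<lambda>p. g (u p))" if "continuous_on UNIV u" for u :: "real \<times> real \<Rightarrow> real"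
    using continuous_on_compose2[OF contg that] by simp
  have "continuous_on UNIV h"
    unfolding h_def by (intro continuous_intros g_comp) auto
  then have "h constant_on UNIV"
  proof (rule continuous_discrete_range_constant[OF connected_UNIV])
    fix p :: "real \<times> real"
    show "\<exists>e>0. \<forall>q. q \<in> UNIV \<and> h q \<noteq> h p \<longrightarrow> e \<le> norm (h q - h p)"
    proof (intro exI[of _ 1] conjI allI impI)
      fix q assume "q \<in> UNIV \<and> h q \<noteq> h p"
      moreover obtain a b :: int where ab: "h q = of_int a" "h p = of_int b"
        using h_int[of q] h_int[of p] by blast
      ultimately have "a \<noteq> b"
        by auto
      moreover have "norm (h q - h p) = \<bar>of_int (a - b)\<bar>"
        using ab by (metis norm_of_int of_int_diff)
      ultimately show "1 \<le> norm (h q - h p)"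
        by linarith
    qed simp
  qed
  then have h_const: "h (s, t) = h (0, 0)" for s t
    unfolding constant_on_def by auto
  have g_add: "g (s + t) - g s - g t = - g 0" for s t
  proof -
    have "g (s + t) - g s - g t = h (s, t) * (2 * pi * \<i>)"
      by (simp add: h_def)
    also have "\<dots> = h (0, 0) * (2 * pi * \<i>)"
      by (simp only: h_const[of s t])
    also have "\<dots> = - g 0"
      by (simp add: h_def)
    finally show ?thesis .
  qed
  have "f 0 = 1"
    using mult[of 0 0] nonzero[of 0] by simp
  then have g0: "exp (g 0) = 1"
    by (simp add: fg)
  show ?thesis
  proof (intro exI[of _ "\<lambda>t. g t - g 0"] conjI allI)
    show "continuous_on UNIV (\<lambda>t. g t - g 0)"
      by (intro continuous_intros contg)
    show "g (s + t) - g 0 = (g s - g 0) + (g t - g 0)" for s t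
      using g_add[of s t] by (simp add: algebra_simps)
    show "f t = exp (g t - g 0)" for t
      by (simp add: fg exp_diff g0)
  qed
qed

lemma continuous_circle_character:
  fixes ch :: "complex \<Rightarrow> complex"
  assumes cont: "continuous_on {z. cmod z = 1} ch"
    and circle: "\<And>z. cmod z = 1 \<Longrightarrow> cmod (ch z) = 1"
    and mult: "\<And>z w. cmod z = 1 \<Longrightarrow> cmod w = 1 \<Longrightarrow> ch (z * w) = ch z * ch w"
  shows "\<exists>n::int. \<forall>z. cmod z = 1 \<longrightarrow> ch z = z powi n"
proof -
  define f where "f t = ch (cis t)" for t
  have f_cont: "continuous_on UNIV f"
    unfolding f_def by (rule continuous_on_compose2[OF cont]) (intro continuous_intros, auto)
  have f_nonzero: "f t \<noteq> 0" for t
    using circle[of "cis t"] by (auto simp: f_def)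
  have f_mult: "f (s + t) = f s * f t" for s t
    using mult[of "cis s" "cis t"] by (simp add: f_def cis_mult)
  obtain G where contG: "continuous_on UNIV G" and addG: "\<forall>s t. G (s + t) = G s + G t"
    and fG: "\<forall>t. f t = exp (G t)"
    using continuous_multiplicative_exp_lift[OF f_cont f_nonzero f_mult] by blast
  have linG: "G t = of_real t * G 1" for t
    using continuous_additive_linear[OF addG[rule_format] contG, of t] by (simp add: scaleR_conv_of_real)
  have "exp (G (2 * pi)) = exp (G 0)"
    using fG[rule_format, of "2 * pi"] fG[rule_format, of 0] by (simp add: f_def)
  then have "exp (G (2 * pi)) = 1"
    using linG[of 0] by simp
  then obtain n :: int where "G (2 * pi) = of_int (2 * n) * pi * \<i>"
    using exp_eq[of "G (2 * pi)" 0] by auto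
  then have G1: "G 1 = \<i> * of_int n"
    using linG[of "2 * pi"] by (simp add: field_simps)
  have "ch z = z powi n" if "cmod z = 1" for z
  proof -
    have z: "z = cis (Arg z)"
      using rcis_cmod_Arg[of z] that by (simp add: rcis_def)
    have "ch z = f (Arg z)"
      by (simp add: f_def z[symmetric])
    also have "\<dots> = exp (G (Arg z))"
      using fG by blast
    also have "\<dots> = cis (of_int n * Arg z)"
      by (simp add: linG[of "Arg z"] G1 cis_conv_exp mult_ac)
    also have "\<dots> = cis (Arg z) powi n"
      by (simp add: cis_power_int)
    also have "\<dots> = z powi n"
      by (simp only: z[symmetric])
    finally show ?thesis .
  qed
  then show ?thesis
    by blast
qed

lemma torus_endomorphism_coordinate_character:
  assumes cont: "continuous_on torus2 \<theta>" and into: "\<And>c. c \<in> torus2 \<Longrightarrow> \<theta> c \<in> torus2"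
    and mult: "\<And>c d. c \<in> torus2 \<Longrightarrow> d \<in> torus2 \<Longrightarrow> \<theta> (torus_mult c d) = torus_mult (\<theta> c) (\<theta> d)"
    and e: "e = (\<lambda>z. (z, 1)) \<or> e = (\<lambda>z. (1, z))"
    and p: "p = fst \<or> p = snd"
  shows "\<exists>n::int. \<forall>z. cmod z = 1 \<longrightarrow> p (\<theta> (e z)) = z powi n"
proof (rule continuous_circle_character)
  have e_torus: "e z \<in> torus2" if "cmod z = 1" for z
    using e that by (auto simp: torus2_def)
  have "continuous_on {z. cmod z = 1} (\<lambda>z. \<theta> (e z))"
    by (rule continuous_on_compose2[OF cont]) (use e e_torus in \<open>auto intro: continuous_intros\<close>)
  then show "continuous_on {z. cmod z = 1} (\<lambda>z. p (\<theta> (e z)))"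
    using p by (auto intro: continuous_intros)
  show "cmod (p (\<theta> (e z))) = 1" if "cmod z = 1" for z
    using into[OF e_torus[OF that]] p by (cases "\<theta> (e z)") (auto simp: torus2_def)
  show "p (\<theta> (e (z * w))) = p (\<theta> (e z)) * p (\<theta> (e w))" if "cmod z = 1" "cmod w = 1" for z w
  proof -
    have "e (z * w) = torus_mult (e z) (e w)"
      using e by (auto simp: torus_mult_def)
    then have "p (\<theta> (e (z * w))) = p (torus_mult (\<theta> (e z)) (\<theta> (e w)))"
      using mult[OF e_torus[OF that(1)] e_torus[OF that(2)]] by simp
    then show ?thesis
      using p by (auto simp: torus_mult_def)
  qed
qed

lemma torus_endomorphism_eq_psi:
  assumes cont: "continuous_on torus2 \<theta>" and into: "\<And>c. c \<in> torus2 \<Longrightarrow> \<theta> c \<in> torus2"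
    and mult: "\<And>c d. c \<in> torus2 \<Longrightarrow> d \<in> torus2 \<Longrightarrow> \<theta> (torus_mult c d) = torus_mult (\<theta> c) (\<theta> d)"
  shows "\<exists>C. \<forall>c\<in>torus2. \<theta> c = psi C c"
proof -
  note character = torus_endomorphism_coordinate_character[OF cont into mult]
  have "\<exists>n. \<forall>z. cmod z = 1 \<longrightarrow> fst (\<theta> (z, 1)) = z powi n"
    by (rule character[of "\<lambda>z. (z, 1)" fst]) simp_all
  then obtain n11 where n11: "\<And>z. cmod z = 1 \<Longrightarrow> fst (\<theta> (z, 1)) = z powi n11"
    by blast
  have "\<exists>n. \<forall>z. cmod z = 1 \<longrightarrow> snd (\<theta> (z, 1)) = z powi n"
    by (rule character[of "\<lambda>z. (z, 1)" snd]) simp_all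
  then obtain n21 where n21: "\<And>z. cmod z = 1 \<Longrightarrow> snd (\<theta> (z, 1)) = z powi n21"
    by blast
  have "\<exists>n. \<forall>z. cmod z = 1 \<longrightarrow> fst (\<theta> (1, z)) = z powi n"
    by (rule character[of "\<lambda>z. (1, z)" fst]) simp_all
  then obtain n12 where n12: "\<And>z. cmod z = 1 \<Longrightarrow> fst (\<theta> (1, z)) = z powi n12"
    by blast
  have "\<exists>n. \<forall>z. cmod z = 1 \<longrightarrow> snd (\<theta> (1, z)) = z powi n"
    by (rule character[of "\<lambda>z. (1, z)" snd]) simp_all
  then obtain n22 where n22: "\<And>z. cmod z = 1 \<Longrightarrow> snd (\<theta> (1, z)) = z powi n22"
    by blast
  define C :: "int^2^2" where
    "C = (\<chi> i j. if i = 1 then (if j = 1 then n11 else n12) else (if j = 1 then n21 else n22))"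
  have "\<theta> c = psi C c" if c: "c \<in> torus2" for c
  proof -
    obtain z w where zw: "c = (z, w)" "cmod z = 1" "cmod w = 1"
      using c by (cases c) (auto simp: torus2_def)
    then have "c = torus_mult (z, 1) (1, w)"
      by (simp add: torus_mult_def)
    then have "\<theta> c = torus_mult (\<theta> (z, 1)) (\<theta> (1, w))"
      using mult[of "(z, 1)" "(1, w)"] zw by (simp add: torus2_def)
    then show ?thesis
      using n11 n12 n21 n22 zw by (simp add: torus_mult_def psi_def C_def)
  qed
  then show ?thesis
    by blast
qed

section \<open>Isomorphisms of topological groups\<close>

lemma top_group_iso_trans:
  assumes "top_group_iso G X H Y" "top_group_iso H Y K Z"
  shows "top_group_iso G X K Z"
proof -
  obtain f where f: "f \<in> iso G H" "homeomorphic_map X Y f"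
    using assms(1) by (auto simp: top_group_iso_def)
  obtain g where g: "g \<in> iso H K" "homeomorphic_map Y Z g"
    using assms(2) by (auto simp: top_group_iso_def)
  have "g \<circ> f \<in> iso G K"
    using f(1) g(1) unfolding iso_def hom_def by (auto simp: Pi_iff intro: bij_betw_trans)
  moreover have "homeomorphic_map X Z (g \<circ> f)"
    by (rule homeomorphic_map_compose[OF f(2) g(2)])
  ultimately show ?thesis
    unfolding top_group_iso_def by blast
qed

text \<open>Closure of \<open>G\<close> is needed: otherwise \<open>x \<otimes> y\<close> might leave the carrier, where \<open>g \<circ> f\<close> need not be
  the identity.\<close>

lemma iso_inverse:
  assumes f: "f \<in> iso G H" and g: "g \<in> carrier H \<rightarrow> carrier G"
    and gf: "\<And>x. x \<in> carrier G \<Longrightarrow> g (f x) = x" and fg: "\<And>y. y \<in> carrier H \<Longrightarrow> f (g y) = y"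
    and closed: "\<And>x y. x \<in> carrier G \<Longrightarrow> y \<in> carrier G \<Longrightarrow> x \<otimes>\<^bsub>G\<^esub> y \<in> carrier G"
  shows "g \<in> iso H G"
proof -
  have f_hom: "f \<in> hom G H"
    using f by (simp add: iso_def)
  have "g (a \<otimes>\<^bsub>H\<^esub> b) = g a \<otimes>\<^bsub>G\<^esub> g b" if "a \<in> carrier H" "b \<in> carrier H" for a b
  proof -
    have ga: "g a \<in> carrier G" and gb: "g b \<in> carrier G"
      using g that by auto
    have "f (g a \<otimes>\<^bsub>G\<^esub> g b) = a \<otimes>\<^bsub>H\<^esub> b"
      using hom_mult[OF f_hom ga gb] fg that by simp
    then have "g (a \<otimes>\<^bsub>H\<^esub> b) = g (f (g a \<otimes>\<^bsub>G\<^esub> g b))"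
      by simp
    also have "\<dots> = g a \<otimes>\<^bsub>G\<^esub> g b"
      by (rule gf[OF closed[OF ga gb]])
    finally show ?thesis .
  qed
  then have "g \<in> hom H G"
    using g by (simp add: hom_def)
  moreover have "bij_betw g (carrier H) (carrier G)"
    by (rule bij_betw_byWitness[where f'=f]) (use gf fg g hom_in_carrier[OF f_hom] in auto)
  ultimately show ?thesis
    by (simp add: iso_def)
qed

lemma homeomorphic_maps_iso_inverse:
  assumes f: "f \<in> iso G H" and maps: "homeomorphic_maps X Y f g"
    and X: "topspace X = carrier G" and Y: "topspace Y = carrier H"
    and closed: "\<And>x y. x \<in> carrier G \<Longrightarrow> y \<in> carrier G \<Longrightarrow> x \<otimes>\<^bsub>G\<^esub> y \<in> carrier G"
  shows "g \<in> iso H G"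
proof (rule iso_inverse[OF f _ _ _ closed])
  show "g \<in> carrier H \<rightarrow> carrier G"
    using maps X Y by (auto simp: homeomorphic_maps_def continuous_map_def)
  show "g (f x) = x" if "x \<in> carrier G" for x
    using maps X that by (simp add: homeomorphic_maps_def)
  show "f (g y) = y" if "y \<in> carrier H" for y
    using maps Y that by (simp add: homeomorphic_maps_def)
qed

lemma top_group_iso_sym:
  assumes "top_group_iso G X H Y"
    and "topspace X = carrier G" "topspace Y = carrier H"
    and "\<And>x y. x \<in> carrier G \<Longrightarrow> y \<in> carrier G \<Longrightarrow> x \<otimes>\<^bsub>G\<^esub> y \<in> carrier G"
  shows "top_group_iso H Y G X"
proof -
  obtain f where f: "f \<in> iso G H" "homeomorphic_map X Y f"
    using assms(1) by (auto simp: top_group_iso_def)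
  then obtain g where g: "homeomorphic_maps X Y f g"
    by (auto simp: homeomorphic_map_maps)
  have "g \<in> iso H G"
    by (rule homeomorphic_maps_iso_inverse[OF f(1) g assms(2-4)])
  moreover have "homeomorphic_map Y X g"
    using g homeomorphic_maps_map homeomorphic_maps_sym by blast
  ultimately show ?thesis
    unfolding top_group_iso_def by blast
qed

section \<open>Composition of automorphisms of \<open>\<A>\<^sub>\<alpha>\<close>\<close>

text \<open>Whether \<open>op x y\<close> stays in \<open>S\<close> is not assumed. If \<open>undefined \<in> S\<close>, the bijection \<open>\<Psi>\<close> forces \<open>S\<close>
  to be closed under \<open>op\<close>; otherwise both sides are \<open>undefined\<close> whenever \<open>op x y \<notin> S\<close>.\<close>

lemma compose_preserves_operation:
  assumes ext: "\<Phi> \<in> extensional S" "\<Psi> \<in> extensional S"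
    and bij: "bij_betw \<Phi> S S" "bij_betw \<Psi> S S"
    and \<Phi>_op: "\<And>x y. x \<in> S \<Longrightarrow> y \<in> S \<Longrightarrow> \<Phi> (op x y) = op (\<Phi> x) (\<Phi> y)"
    and \<Psi>_op: "\<And>x y. x \<in> S \<Longrightarrow> y \<in> S \<Longrightarrow> \<Psi> (op x y) = op (\<Psi> x) (\<Psi> y)"
    and xy: "x \<in> S" "y \<in> S"
  shows "compose S \<Phi> \<Psi> (op x y) = op (compose S \<Phi> \<Psi> x) (compose S \<Phi> \<Psi> y)"
proof (cases "op x y \<in> S")
  case True
  then show ?thesis
    using xy bij by (simp add: compose_eq \<Psi>_op \<Phi>_op bij_betwE)
next
  case False
  have "undefined \<notin> S"
  proof
    assume undef: "undefined \<in> S"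
    obtain x' y' where "x' \<in> S" "y' \<in> S" "x = \<Psi> x'" "y = \<Psi> y'"
      using xy bij(2) by (metis bij_betw_imp_surj_on imageE)
    then have "op x y = \<Psi> (op x' y')"
      by (simp add: \<Psi>_op)
    moreover have "\<Psi> z \<in> S" for z
      using bij(2) ext(2) undef by (cases "z \<in> S") (auto simp: bij_betwE extensional_def)
    ultimately show False
      using False by simp
  qed
  then have "\<Phi> undefined = undefined"
    using ext(1) by (simp add: extensional_def)
  moreover have "op (\<Psi> x) (\<Psi> y) = undefined"
    using \<Psi>_op[OF xy] ext(2) False by (simp add: extensional_def)
  ultimately show ?thesis
    using False xy bij(2) by (simp add: compose_def \<Phi>_op[symmetric] bij_betwE)
qed

lemma compose_in_Aut_set:
  assumes "\<Phi> \<in> Aut_set \<alpha>" "\<Psi> \<in> Aut_set \<alpha>"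
  shows "compose (A_alg \<alpha>) \<Phi> \<Psi> \<in> Aut_set \<alpha>"
proof -
  let ?A = "A_alg \<alpha>" and ?C = "compose (A_alg \<alpha>) \<Phi> \<Psi>"
  have ext: "\<Phi> \<in> extensional ?A" "\<Psi> \<in> extensional ?A"
    and bij: "bij_betw \<Phi> ?A ?A" "bij_betw \<Psi> ?A ?A"
    and add: "\<And>f g. f \<in> ?A \<Longrightarrow> g \<in> ?A \<Longrightarrow> \<Phi> (\<lambda>x. f x + g x) = (\<lambda>x. \<Phi> f x + \<Phi> g x)"
      "\<And>f g. f \<in> ?A \<Longrightarrow> g \<in> ?A \<Longrightarrow> \<Psi> (\<lambda>x. f x + g x) = (\<lambda>x. \<Psi> f x + \<Psi> g x)"
    and mult: "\<And>f g. f \<in> ?A \<Longrightarrow> g \<in> ?A \<Longrightarrow> \<Phi> (\<lambda>x. f x * g x) = (\<lambda>x. \<Phi> f x * \<Phi> g x)"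
      "\<And>f g. f \<in> ?A \<Longrightarrow> g \<in> ?A \<Longrightarrow> \<Psi> (\<lambda>x. f x * g x) = (\<lambda>x. \<Psi> f x * \<Psi> g x)"
    and smult: "\<And>c f. f \<in> ?A \<Longrightarrow> \<Phi> (\<lambda>x. c * f x) = (\<lambda>x. c * \<Phi> f x)"
      "\<And>c f. f \<in> ?A \<Longrightarrow> \<Psi> (\<lambda>x. c * f x) = (\<lambda>x. c * \<Psi> f x)"
    and norm: "\<And>f. f \<in> ?A \<Longrightarrow> supnorm (\<Phi> f) = supnorm f" "\<And>f. f \<in> ?A \<Longrightarrow> supnorm (\<Psi> f) = supnorm f"
    using assms by (simp_all add: Aut_set_def)
  note compose_op = compose_preserves_operation[OF ext bij]
  have "bij_betw (\<Phi> \<circ> \<Psi>) ?A ?A"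
    by (rule bij_betw_trans[OF bij(2) bij(1)])
  then have "bij_betw ?C ?A ?A"
    by (rule bij_betw_cong[THEN iffD1, rotated]) (simp add: compose_eq)
  moreover have "?C (\<lambda>x. f x + g x) = (\<lambda>x. ?C f x + ?C g x)" if "f \<in> ?A" "g \<in> ?A" for f g
    by (rule compose_op[where op = "\<lambda>f g x. f x + g x" and x = f and y = g, simplified])
      (simp_all add: add that)
  moreover have "?C (\<lambda>x. f x * g x) = (\<lambda>x. ?C f x * ?C g x)" if "f \<in> ?A" "g \<in> ?A" for f g
    by (rule compose_op[where op = "\<lambda>f g x. f x * g x" and x = f and y = g, simplified])
      (simp_all add: mult that)
  moreover have "?C (\<lambda>x. c * f x) = (\<lambda>x. c * ?C f x)" if "f \<in> ?A" for c f
    by (rule compose_op[where op = "\<lambda>f g x. c * f x" and x = f and y = f, simplified])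
      (simp_all add: smult that)
  moreover have "supnorm (?C f) = supnorm f" if "f \<in> ?A" for f
    using norm bij(2) that by (simp add: compose_eq bij_betwE)
  ultimately show ?thesis
    unfolding Aut_set_def by simp
qed

lemma topspace_AutTop: "topspace (AutTop \<alpha>) = carrier (AutG \<alpha>)"
  unfolding AutTop_def AutG_def by auto

lemma AutG_mult_closed:
  "\<Phi> \<in> carrier (AutG \<alpha>) \<Longrightarrow> \<Psi> \<in> carrier (AutG \<alpha>) \<Longrightarrow> \<Phi> \<otimes>\<^bsub>AutG \<alpha>\<^esub> \<Psi> \<in> carrier (AutG \<alpha>)"
  by (simp add: AutG_def compose_in_Aut_set)

section \<open>Continuous homomorphisms of the semidirect products\<close>

lemma carrier_semidirect: "carrier (semidirect A) = torus2 \<times> UNIV"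
  by (simp add: semidirect_def)

lemma semidirect_mult:
  "(c, m) \<otimes>\<^bsub>semidirect A\<^esub> (d, n) = (torus_mult c (psi (mpow A m) d), m + n)"
  by (simp add: semidirect_def torus_mult_def Let_def)

lemma snd_semidirect_mult: "snd (x \<otimes>\<^bsub>semidirect A\<^esub> y) = snd x + snd y"
  by (cases x, cases y) (simp add: semidirect_mult)

lemma topspace_semidirectTop: "topspace semidirectTop = torus2 \<times> UNIV"
  by (simp add: semidirectTop_def)

lemma semidirect_mult_closed:
  "x \<in> carrier (semidirect A) \<Longrightarrow> y \<in> carrier (semidirect A) \<Longrightarrow> x \<otimes>\<^bsub>semidirect A\<^esub> y \<in> carrier (semidirect A)"
  by (cases x, cases y) (auto simp: carrier_semidirect semidirect_mult intro!: torus_mult_in_torus2 psi_in_torus2)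

lemma semidirect_hom_one:
  assumes hom: "\<phi> \<in> hom (semidirect A) (semidirect B)"
  shows "\<phi> ((1, 1), 0) = ((1, 1), 0)"
proof -
  have one: "((1, 1), 0) \<in> carrier (semidirect A)"
    by (simp add: carrier_semidirect)
  obtain c m where cm: "\<phi> ((1, 1), 0) = (c, m)"
    by (cases "\<phi> ((1, 1), 0)")
  have c: "c \<in> torus2"
    using hom_in_carrier[OF hom one] cm by (simp add: carrier_semidirect)
  have "((1, 1), 0) \<otimes>\<^bsub>semidirect A\<^esub> ((1, 1), 0) = ((1, 1), 0)"
    by (simp add: semidirect_mult)
  then have cm_square: "(c, m) = (c, m) \<otimes>\<^bsub>semidirect B\<^esub> (c, m)"
    using hom_mult[OF hom one one] cm by simp
  then have "m = 0"
    by (simp add: semidirect_mult)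
  moreover from this cm_square have "(c, 0) = (c, 0) \<otimes>\<^bsub>semidirect B\<^esub> (c, 0)"
    by simp
  then have "c = torus_mult c c"
    by (simp add: semidirect_mult)
  then have "c = (1, 1)"
    using torus2_nonzero[OF c] by (cases c) (auto simp: torus_mult_def)
  ultimately show ?thesis
    using cm by simp
qed

text \<open>Connectedness: the image of \<open>\<T>\<^sup>2 \<times> {0}\<close> in the discrete factor \<open>\<int>\<close> is a point.\<close>

lemma semidirect_continuous_hom_torus:
  assumes hom: "\<phi> \<in> hom (semidirect A) (semidirect B)"
    and cont: "continuous_map semidirectTop semidirectTop \<phi>"
    and c: "c \<in> torus2"
  shows "snd (\<phi> (c, 0)) = 0"
proof -
  have "connectedin semidirectTop (torus2 \<times> {0})"
    unfolding semidirectTop_def connectedin_Times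
    by (simp add: connected_torus2 connectedin_discrete_topology)
  moreover have "continuous_map semidirectTop (discrete_topology UNIV) (snd \<circ> \<phi>)"
    using cont unfolding semidirectTop_def by (rule continuous_map_compose[OF _ continuous_map_snd])
  ultimately have "connectedin (discrete_topology UNIV) ((snd \<circ> \<phi>) ` (torus2 \<times> {0}))"
    by (rule connectedin_continuous_map_image[rotated])
  then obtain a where a: "(snd \<circ> \<phi>) ` (torus2 \<times> {0}) \<subseteq> {a}"
    by (auto simp: connectedin_discrete_topology)
  moreover have "(snd \<circ> \<phi>) ((1, 1), 0) \<in> (snd \<circ> \<phi>) ` (torus2 \<times> {0})"
    by (rule imageI) simp
  ultimately have "a = 0"
    using semidirect_hom_one[OF hom] by auto
  then show ?thesis
    using a c by auto
qed

lemma additive_int_eq_mult: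
  fixes h :: "int \<Rightarrow> int"
  assumes add: "\<And>m n. h (m + n) = h m + h n"
  shows "h m = m * h 1"
proof -
  have h0: "h 0 = 0"
    using add[of 0 0] by simp
  have nat: "h (int n) = int n * h 1" for n
  proof (induction n)
    case 0
    then show ?case by (simp add: h0)
  next
    case (Suc n)
    then show ?case using add[of "int n" 1] by (simp add: algebra_simps)
  qed
  show ?thesis
  proof (cases "m \<ge> 0")
    case True
    then show ?thesis using nat[of "nat m"] by simp
  next
    case False
    have "h (- m) + h m = 0"
      using add[of "- m" m] h0 by simp
    moreover have "h (- m) = (- m) * h 1"
      using nat[of "nat (- m)"] False by simp
    ultimately show ?thesis
      by (simp add: algebra_simps)
  qed
qed

lemma semidirect_continuous_hom_structure:
  assumes hom: "\<phi> \<in> hom (semidirect A) (semidirect B)"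
    and cont: "continuous_map semidirectTop semidirectTop \<phi>"
  shows "\<exists>C k. (\<forall>c\<in>torus2. \<phi> (c, 0) = (psi C c, 0)) \<and> (\<forall>c\<in>torus2. \<forall>m. snd (\<phi> (c, m)) = m * k)"
proof -
  define \<theta> where "\<theta> c = fst (\<phi> (c, 0))" for c
  have \<phi>_torus: "\<phi> (c, 0) = (\<theta> c, 0)" if "c \<in> torus2" for c
    using semidirect_continuous_hom_torus[OF hom cont that] by (simp add: \<theta>_def prod_eq_iff)
  have \<theta>_into: "\<theta> c \<in> torus2" if "c \<in> torus2" for c
    using hom_in_carrier[OF hom, of "(c, 0)"] that \<phi>_torus[OF that] by (simp add: carrier_semidirect)
  have "continuous_map (top_of_set torus2) semidirectTop (\<lambda>c. (c, 0::int))"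
    unfolding semidirectTop_def
    by (intro continuous_map_pairedI continuous_map_id continuous_map_const[THEN iffD2]) auto
  then have "continuous_map (top_of_set torus2) semidirectTop (\<phi> \<circ> (\<lambda>c. (c, 0::int)))"
    using cont by (rule continuous_map_compose)
  then have "continuous_map (top_of_set torus2) (top_of_set torus2) (fst \<circ> (\<phi> \<circ> (\<lambda>c. (c, 0::int))))"
    by (rule continuous_map_compose) (simp add: semidirectTop_def continuous_map_fst)
  then have \<theta>_cont: "continuous_on torus2 \<theta>"
    by (simp add: \<theta>_def[abs_def] comp_def)
  have \<theta>_mult: "\<theta> (torus_mult c d) = torus_mult (\<theta> c) (\<theta> d)" if cd: "c \<in> torus2" "d \<in> torus2" for c d
  proof -
    have "\<phi> (torus_mult c d, 0) = \<phi> (c, 0) \<otimes>\<^bsub>semidirect B\<^esub> \<phi> (d, 0)"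
      using hom_mult[OF hom, of "(c, 0)" "(d, 0)"] cd by (simp add: carrier_semidirect semidirect_mult)
    then show ?thesis
      using \<phi>_torus cd torus_mult_in_torus2[OF cd] by (simp add: semidirect_mult)
  qed
  obtain C where C: "\<And>c. c \<in> torus2 \<Longrightarrow> \<theta> c = psi C c"
    using torus_endomorphism_eq_psi[OF \<theta>_cont \<theta>_into \<theta>_mult] by blast
  define h where "h m = snd (\<phi> ((1, 1), m))" for m
  have "h (m + n) = h m + h n" for m n
  proof -
    have "\<phi> ((1, 1), m + n) = \<phi> ((1, 1), m) \<otimes>\<^bsub>semidirect B\<^esub> \<phi> ((1, 1), n)"
      using hom_mult[OF hom, of "((1, 1), m)" "((1, 1), n)"] by (simp add: carrier_semidirect semidirect_mult)
    then show ?thesis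
      by (simp add: h_def snd_semidirect_mult)
  qed
  then have h: "h m = m * h 1" for m
    by (rule additive_int_eq_mult)
  have "snd (\<phi> (c, m)) = m * h 1" if c: "c \<in> torus2" for c m
  proof -
    have "\<phi> (c, m) = \<phi> (c, 0) \<otimes>\<^bsub>semidirect B\<^esub> \<phi> ((1, 1), m)"
      using hom_mult[OF hom, of "(c, 0)" "((1, 1), m)"] c by (simp add: carrier_semidirect semidirect_mult)
    then show ?thesis
      using semidirect_continuous_hom_torus[OF hom cont c] h[of m]
      by (simp add: h_def snd_semidirect_mult)
  qed
  moreover have "\<phi> (c, 0) = (psi C c, 0)" if "c \<in> torus2" for c
    using \<phi>_torus C that by simp
  ultimately show ?thesis
    by (intro exI[of _ C] exI[of _ "h 1"]) simp
qed

text \<open>Apply \<open>\<phi>\<close> to \<open>g (c, 0) = (\<psi>\<^sub>A c, 0) g\<close> with \<open>g = ((1,1), 1)\<close>.\<close>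

lemma semidirect_hom_conjugation:
  assumes hom: "\<phi> \<in> hom (semidirect A) (semidirect B)"
    and C: "\<And>c. c \<in> torus2 \<Longrightarrow> \<phi> (c, 0) = (psi C c, 0)"
    and k: "\<And>c m. c \<in> torus2 \<Longrightarrow> snd (\<phi> (c, m)) = m * k"
  shows "mpow B k ** C = C ** A"
proof (rule psi_inject)
  fix c assume c: "c \<in> torus2"
  define g :: "(complex \<times> complex) \<times> int" where "g = ((1, 1), 1)"
  have g: "g \<in> carrier (semidirect A)"
    by (simp add: g_def carrier_semidirect)
  obtain d k' where d: "\<phi> g = (d, k')"
    by (cases "\<phi> g")
  moreover have "snd (\<phi> g) = k"
    using k[of "(1, 1)" 1] by (simp add: g_def)
  ultimately have d: "\<phi> g = (d, k)"
    by simp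
  have d_torus: "d \<in> torus2"
    using hom_in_carrier[OF hom g] d by (simp add: carrier_semidirect)
  have Ac: "psi A c \<in> torus2"
    using c by (rule psi_in_torus2)
  have "g \<otimes>\<^bsub>semidirect A\<^esub> (c, 0) = (psi A c, 0) \<otimes>\<^bsub>semidirect A\<^esub> g"
    by (simp add: g_def semidirect_mult)
  moreover have "(c, 0) \<in> carrier (semidirect A)" "(psi A c, 0) \<in> carrier (semidirect A)"
    using c Ac by (simp_all add: carrier_semidirect)
  ultimately have "\<phi> g \<otimes>\<^bsub>semidirect B\<^esub> \<phi> (c, 0) = \<phi> (psi A c, 0) \<otimes>\<^bsub>semidirect B\<^esub> \<phi> g"
    by (simp flip: hom_mult[OF hom] add: g)
  then have "torus_mult d (psi (mpow B k) (psi C c)) = torus_mult (psi C (psi A c)) d"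
    using d C c Ac by (simp add: semidirect_mult)
  then have "psi (mpow B k) (psi C c) = psi C (psi A c)"
    by (rule torus_mult_cancel[OF d_torus])
  then show "psi (mpow B k ** C) c = psi (C ** A) c"
    using psi_psi[OF c] by simp
qed

lemma semidirect_top_group_iso_imp_conjugate:
  assumes "top_group_iso (semidirect A) semidirectTop (semidirect B) semidirectTop"
  shows "\<exists>C\<in>GL2Z. B = matrix_inv C ** A ** C \<or> matrix_inv B = matrix_inv C ** A ** C"
proof -
  obtain \<phi> where \<phi>: "\<phi> \<in> iso (semidirect A) (semidirect B)" "homeomorphic_map semidirectTop semidirectTop \<phi>"
    using assms by (auto simp: top_group_iso_def)
  then obtain \<psi> where maps: "homeomorphic_maps semidirectTop semidirectTop \<phi> \<psi>"
    by (auto simp: homeomorphic_map_maps)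
  then have \<psi>\<phi>: "\<And>x. x \<in> torus2 \<times> UNIV \<Longrightarrow> \<psi> (\<phi> x) = x" and \<phi>\<psi>: "\<And>x. x \<in> torus2 \<times> UNIV \<Longrightarrow> \<phi> (\<psi> x) = x"
    by (auto simp: homeomorphic_maps_def topspace_semidirectTop)
  have \<psi>: "\<psi> \<in> iso (semidirect B) (semidirect A)"
    by (rule homeomorphic_maps_iso_inverse[OF \<phi>(1) maps])
      (simp_all add: topspace_semidirectTop carrier_semidirect semidirect_mult_closed[unfolded carrier_semidirect])
  have \<phi>_hom: "\<phi> \<in> hom (semidirect A) (semidirect B)" and \<psi>_hom: "\<psi> \<in> hom (semidirect B) (semidirect A)"
    using \<phi>(1) \<psi> by (simp_all add: iso_def)
  have \<phi>_cont: "continuous_map semidirectTop semidirectTop \<phi>"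
    and \<psi>_cont: "continuous_map semidirectTop semidirectTop \<psi>"
    using maps by (simp_all add: homeomorphic_maps_def)
  obtain C k where C: "\<forall>c\<in>torus2. \<phi> (c, 0) = (psi C c, 0)"
    and k: "\<forall>c\<in>torus2. \<forall>m. snd (\<phi> (c, m)) = m * k"
    using semidirect_continuous_hom_structure[OF \<phi>_hom \<phi>_cont] by blast
  obtain D where D: "\<forall>c\<in>torus2. \<psi> (c, 0) = (psi D c, 0)"
    using semidirect_continuous_hom_structure[OF \<psi>_hom \<psi>_cont] by blast
  have DC: "D ** C = mat 1"
  proof (rule psi_inject)
    fix c assume c: "c \<in> torus2"
    have "(c, 0) = \<psi> (\<phi> (c, 0))"
      using \<psi>\<phi> c by simp
    also have "\<dots> = (psi D (psi C c), 0)"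
      using C D c psi_in_torus2 by simp
    finally show "psi (D ** C) c = psi (mat 1) c"
      using psi_psi[OF c] by simp
  qed
  have CD: "C ** D = mat 1"
  proof (rule psi_inject)
    fix c assume c: "c \<in> torus2"
    have "(c, 0) = \<phi> (\<psi> (c, 0))"
      using \<phi>\<psi> c by simp
    also have "\<dots> = (psi C (psi D c), 0)"
      using C D c psi_in_torus2 by simp
    finally show "psi (C ** D) c = psi (mat 1) c"
      using psi_psi[OF c] by simp
  qed
  have "k = 1 \<or> k = -1"
  proof -
    have "((1, 1), 1) \<in> \<phi> ` carrier (semidirect A)"
      using \<phi>(1) by (simp add: iso_def bij_betw_def carrier_semidirect)
    then obtain c m where "c \<in> torus2" "\<phi> (c, m) = ((1, 1), 1)"
      by (auto simp: carrier_semidirect)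
    then have "m * k = 1"
      using k[rule_format, of c m] by simp
    then show ?thesis
      using zmult_eq_1_iff by blast
  qed
  moreover have "mpow B k = matrix_inv D ** A ** D"
  proof -
    have "mpow B k = mpow B k ** (C ** D)"
      by (simp add: CD)
    also have "\<dots> = C ** A ** D"
      by (simp add: semidirect_hom_conjugation[OF \<phi>_hom C[rule_format] k[rule_format]] matrix_mul_assoc)
    finally show ?thesis
      by (simp add: matrix_inv_unique[OF DC CD])
  qed
  moreover have "D \<in> GL2Z"
    using DC CD by (auto simp: GL2Z_def invertible_def)
  ultimately show ?thesis
    by auto
qed

section \<open>Conjugate matrices give isomorphic semidirect products\<close>

definition semidirect_map :: "int^2^2 \<Rightarrow> int \<Rightarrow> (complex \<times> complex) \<times> int \<Rightarrow> (complex \<times> complex) \<times> int" where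
  "semidirect_map D s x = (psi D (fst x), s * snd x)"

lemma semidirect_map_in_carrier: "x \<in> torus2 \<times> UNIV \<Longrightarrow> semidirect_map D s x \<in> torus2 \<times> UNIV"
  by (auto simp: semidirect_map_def psi_in_torus2)

lemma semidirect_map_inverse:
  assumes "C ** D = mat 1" "s * s = 1" "x \<in> torus2 \<times> UNIV"
  shows "semidirect_map C s (semidirect_map D s x) = x"
  using assms psi_psi[of "fst x" C D] by (auto simp: semidirect_map_def mult.assoc[symmetric])

lemma continuous_map_semidirect_map: "continuous_map semidirectTop semidirectTop (semidirect_map D s)"
proof -
  have "continuous_map (top_of_set torus2) (top_of_set torus2) (psi D)"
    using continuous_on_psi psi_in_torus2 by auto
  then have "continuous_map semidirectTop (top_of_set torus2) (psi D \<circ> fst)"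
    unfolding semidirectTop_def by (rule continuous_map_compose[OF continuous_map_fst])
  moreover have "continuous_map semidirectTop (discrete_topology UNIV) ((\<lambda>m. s * m) \<circ> snd)"
    unfolding semidirectTop_def by (rule continuous_map_compose[OF continuous_map_snd]) simp
  ultimately show ?thesis
    unfolding semidirectTop_def semidirect_map_def comp_def by (intro continuous_map_pairedI)
qed

lemma semidirect_map_mult:
  assumes conj: "\<And>m. mpow B (s * m) ** D = D ** mpow A m"
    and x: "x \<in> torus2 \<times> UNIV" and y: "y \<in> torus2 \<times> UNIV"
  shows "semidirect_map D s (x \<otimes>\<^bsub>semidirect A\<^esub> y) = semidirect_map D s x \<otimes>\<^bsub>semidirect B\<^esub> semidirect_map D s y"
proof -
  obtain c m d n where xy: "x = (c, m)" "y = (d, n)" and d: "d \<in> torus2"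
    using x y by auto
  have "psi D (psi (mpow A m) d) = psi (mpow B (s * m)) (psi D d)"
    by (simp add: psi_psi[OF d] psi_psi[OF psi_in_torus2[OF d]] conj)
  then show ?thesis
    by (simp add: xy semidirect_mult semidirect_map_def psi_torus_mult distrib_left)
qed

lemma conjugate_imp_semidirect_top_group_iso:
  assumes A: "invertible A" and B: "invertible B" and C: "invertible C"
    and conj: "B = matrix_inv C ** A ** C \<or> matrix_inv B = matrix_inv C ** A ** C"
  shows "top_group_iso (semidirect A) semidirectTop (semidirect B) semidirectTop"
proof -
  obtain s :: int where s: "s * s = 1" and powers: "\<And>m. mpow B (s * m) = matrix_inv C ** mpow A m ** C"
  proof (cases "B = matrix_inv C ** A ** C")
    case True
    show ?thesis
      by (rule that[of 1]) (simp_all add: True mpow_conj[OF C A])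
  next
    case False
    then have "matrix_inv B = matrix_inv C ** A ** C"
      using conj by simp
    then show ?thesis
      by (intro that[of "-1"]) (simp_all add: mpow_matrix_inv[OF B, symmetric] mpow_conj[OF C A])
  qed
  define D where "D = matrix_inv C"
  have CD: "C ** D = mat 1" and DC: "D ** C = mat 1"
    using matrix_inv_right[OF C] matrix_inv_left[OF C] by (simp_all add: D_def)
  have "mpow B (s * m) ** D = D ** mpow A m" for m
    by (simp add: powers D_def matrix_mul_assoc[symmetric] matrix_inv_right[OF C])
  then have "semidirect_map D s \<in> hom (semidirect A) (semidirect B)"
    unfolding hom_def carrier_semidirect using semidirect_map_in_carrier semidirect_map_mult
    by (auto simp: Pi_iff)
  moreover have "semidirect_map X s ` (torus2 \<times> UNIV) \<subseteq> torus2 \<times> UNIV" for X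
    by (rule image_subsetI) (rule semidirect_map_in_carrier)
  then have "bij_betw (semidirect_map D s) (torus2 \<times> UNIV) (torus2 \<times> UNIV)"
    by (intro bij_betw_byWitness[where f' = "semidirect_map C s"])
      (simp_all add: semidirect_map_inverse[OF CD s] semidirect_map_inverse[OF DC s])
  moreover have "homeomorphic_maps semidirectTop semidirectTop (semidirect_map D s) (semidirect_map C s)"
    unfolding homeomorphic_maps_def topspace_semidirectTop
    by (simp add: continuous_map_semidirect_map semidirect_map_inverse[OF CD s] semidirect_map_inverse[OF DC s])
  ultimately show ?thesis
    unfolding top_group_iso_def iso_def carrier_semidirect using homeomorphic_maps_map by blast
qed

theorem mainTheorem14:
  fixes \<alpha> \<beta> :: real and A B :: "int^2^2"
  assumes "\<alpha> > 0" "quadratic_irrational \<alpha>"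
    and "\<beta> > 0" "quadratic_irrational \<beta>"
    and "A \<in> GL2Z" "B \<in> GL2Z" "A \<noteq> mat 1" "B \<noteq> mat 1"
    and "top_group_iso (AutG \<alpha>) (AutTop \<alpha>) (semidirect A) semidirectTop"
    and "top_group_iso (AutG \<beta>) (AutTop \<beta>) (semidirect B) semidirectTop"
  shows "top_group_iso (AutG \<alpha>) (AutTop \<alpha>) (AutG \<beta>) (AutTop \<beta>) \<longleftrightarrow>
    (\<exists>C\<in>GL2Z. B = matrix_inv C ** A ** C \<or> matrix_inv B = matrix_inv C ** A ** C)"
proof -
  have A: "invertible A" and B: "invertible B"
    using assms(5,6) by (auto simp: GL2Z_def)
  have sym_\<alpha>: "top_group_iso (semidirect A) semidirectTop (AutG \<alpha>) (AutTop \<alpha>)"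
    by (rule top_group_iso_sym[OF assms(9) topspace_AutTop])
      (auto simp: topspace_semidirectTop carrier_semidirect intro: AutG_mult_closed)
  have sym_\<beta>: "top_group_iso (semidirect B) semidirectTop (AutG \<beta>) (AutTop \<beta>)"
    by (rule top_group_iso_sym[OF assms(10) topspace_AutTop])
      (auto simp: topspace_semidirectTop carrier_semidirect intro: AutG_mult_closed)
  show ?thesis
  proof
    assume "top_group_iso (AutG \<alpha>) (AutTop \<alpha>) (AutG \<beta>) (AutTop \<beta>)"
    then have "top_group_iso (semidirect A) semidirectTop (semidirect B) semidirectTop"
      by (rule top_group_iso_trans[OF top_group_iso_trans[OF sym_\<alpha>] assms(10)])
    then show "\<exists>C\<in>GL2Z. B = matrix_inv C ** A ** C \<or> matrix_inv B = matrix_inv C ** A ** C"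
      by (rule semidirect_top_group_iso_imp_conjugate)
  next
    assume "\<exists>C\<in>GL2Z. B = matrix_inv C ** A ** C \<or> matrix_inv B = matrix_inv C ** A ** C"
    then obtain C where "invertible C" "B = matrix_inv C ** A ** C \<or> matrix_inv B = matrix_inv C ** A ** C"
      by (auto simp: GL2Z_def)
    then have "top_group_iso (semidirect A) semidirectTop (semidirect B) semidirectTop"
      by (rule conjugate_imp_semidirect_top_group_iso[OF A B])
    then show "top_group_iso (AutG \<alpha>) (AutTop \<alpha>) (AutG \<beta>) (AutTop \<beta>)"
      by (rule top_group_iso_trans[OF top_group_iso_trans[OF assms(9)] sym_\<beta>])
  qed
qed

end
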